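(* Let $S$ be a polynomial ring in finitely many variables over a field $K$ and let $I\subset S$ be an ideal minimally generated by three quadratic binomials. Suppose that (i) $I$ is prime and (ii) $I$ has linear resolution. Then there is a matrix whose entries are (not necessarily distinct) variables of $S$ such that $I$ is generated by all $2$-minors of this matrix. If, in addition, $I$ is minimally generated by three quadratic squarefree binomials, then there are six pairwise distinct variables $x_1,x_2,x_3,y_1,y_2,y_3$ of $S$ such that $$I=(x_1y_2-x_2y_1,\; x_1y_3-x_3y_1,\; x_2y_3-x_3y_2).$$
   Context: $S$ has the standard grading. A quadratic binomial is a polynomial $u-v$ with $u\neq v$ monomials of degree $2$ in $S$; it is squarefree if both $u$ and $v$ are squarefree monomials. An ideal generated in degree $2$ has linear resolution if its minimal graded free resolution is linear, i.e. its Castelnuovo--Mumford regularity equals $2$. *)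

theory Defs
  imports
    "HOL-Library.Poly_Mapping"
    "HOL-Algebra.Ideal"
    "Jordan_Normal_Form.DL_Submatrix"
    "Jordan_Normal_Form.Determinant"
    "Jordan_Normal_Form.VS_Connect"
    "Jordan_Normal_Form.Matrix_Kernel"
begin

section \<open>Polynomials in finitely many variables\<close>

text \<open>
  The variables are the elements of a finite type \<open>'x\<close>.  A monomial is its exponent vector, and
  \<open>('x, 'k) mpoly\<close> with the ring structure of \<^theory>\<open>HOL-Library.Poly_Mapping\<close> is the polynomial
  ring \<open>K[x. x \<in> 'x]\<close>.  Its ideals are taken in the sense of HOL-Algebra, in the ring
  \<^term>\<open>class_ring\<close> given by the type class operations.
\<close>

type_synonym 'x monomial = "'x \<Rightarrow>\<^sub>0 nat"
type_synonym ('x, 'k) mpoly = "'x monomial \<Rightarrow>\<^sub>0 'k"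

definition mmonom :: "'x monomial \<Rightarrow> ('x, 'k::field) mpoly" where
  "mmonom u = Poly_Mapping.single u 1"

definition Var :: "'x \<Rightarrow> ('x, 'k::field) mpoly" where
  "Var x = mmonom (Poly_Mapping.single x 1)"

definition mdeg :: "'x::finite monomial \<Rightarrow> nat" where
  "mdeg u = (\<Sum>x\<in>UNIV. Poly_Mapping.lookup u x)"

definition squarefree_monomial :: "'x monomial \<Rightarrow> bool" where
  "squarefree_monomial u \<longleftrightarrow> (\<forall>x. Poly_Mapping.lookup u x \<le> 1)"

definition ideal_gen :: "('x, 'k::field) mpoly set \<Rightarrow> ('x, 'k) mpoly set" where
  "ideal_gen G = Idl\<^bsub>class_ring\<^esub> G"

definition minimal_generating_set ::
    "('x, 'k::field) mpoly set \<Rightarrow> ('x, 'k) mpoly set \<Rightarrow> bool" where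
  "minimal_generating_set G I \<longleftrightarrow> ideal_gen G = I \<and> (\<forall>H. H \<subset> G \<longrightarrow> ideal_gen H \<noteq> I)"

definition quadratic_binomial :: "('x::finite, 'k::field) mpoly \<Rightarrow> bool" where
  "quadratic_binomial f \<longleftrightarrow>
     (\<exists>u v. u \<noteq> v \<and> mdeg u = 2 \<and> mdeg v = 2 \<and> f = mmonom u - mmonom v)"

definition squarefree_quadratic_binomial :: "('x::finite, 'k::field) mpoly \<Rightarrow> bool" where
  "squarefree_quadratic_binomial f \<longleftrightarrow>
     (\<exists>u v. u \<noteq> v \<and> mdeg u = 2 \<and> mdeg v = 2 \<and>
        squarefree_monomial u \<and> squarefree_monomial v \<and> f = mmonom u - mmonom v)"


section \<open>Minors\<close>

definition minors :: "nat \<Rightarrow> 'a::comm_ring_1 mat \<Rightarrow> 'a set" where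
  "minors k A = {det (submatrix A R C) | R C.
     R \<subseteq> {..<dim_row A} \<and> C \<subseteq> {..<dim_col A} \<and> card R = k \<and> card C = k}"


section \<open>Graded free resolutions\<close>

text \<open>
  A list \<open>ds\<close> of natural numbers stands for the graded free module
  \<open>S(-ds!0) \<oplus> S(-ds!1) \<oplus> \<dots>\<close>, whose \<open>j\<close>-th basis element has degree \<open>ds!j\<close>.  The matrix \<open>A\<close> is a
  homomorphism of degree 0 from the module of \<open>ds\<close> to the module of \<open>es\<close> if its entry \<open>(r,c)\<close> is
  homogeneous of degree \<open>ds!c - es!r\<close> (and zero if this is negative).
\<close>

definition graded_hom ::
    "nat list \<Rightarrow> nat list \<Rightarrow> ('x::finite, 'k::field) mpoly mat \<Rightarrow> bool" where
  "graded_hom ds es A \<longleftrightarrow> A \<in> carrier_mat (length es) (length ds) \<and>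
     (\<forall>r<length es. \<forall>c<length ds. \<forall>u\<in>Poly_Mapping.keys (A $$ (r, c)). mdeg u + es ! r = ds ! c)"

definition mat_image :: "'a::comm_ring_1 mat \<Rightarrow> 'a vec set" where
  "mat_image A = (\<lambda>v. A *\<^sub>v v) ` carrier_vec (dim_col A)"

text \<open>
  The complex \<open>\<dots> \<rightarrow> F 2 \<rightarrow> F 1 \<rightarrow> F 0 \<rightarrow> I \<rightarrow> 0\<close> with \<open>F i\<close> the module of \<open>d i\<close>.  The map \<open>F 0 \<rightarrow> I\<close>,
  followed by the inclusion of \<open>I\<close> into \<open>S\<close>, is the one-row matrix \<open>M 0\<close>; the map
  \<open>F (i + 1) \<rightarrow> F i\<close> is \<open>M (i + 1)\<close>.
\<close>

definition graded_free_resolution ::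
    "('x::finite, 'k::field) mpoly set \<Rightarrow> (nat \<Rightarrow> nat list) \<Rightarrow> (nat \<Rightarrow> ('x, 'k) mpoly mat) \<Rightarrow> bool" where
  "graded_free_resolution I d M \<longleftrightarrow>
     graded_hom (d 0) [0] (M 0) \<and>
     (\<forall>i. graded_hom (d (Suc i)) (d i) (M (Suc i))) \<and>
     (\<lambda>w. w $ 0) ` mat_image (M 0) = I \<and>
     (\<forall>i. mat_kernel (M i) = mat_image (M (Suc i)))"

text \<open>
  Minimality, \<open>im (F (i + 1) \<rightarrow> F i) \<subseteq> \<mm> F i\<close>, says that the entries of the differentials lie in the
  ideal \<open>\<mm>\<close> generated by the variables.  It does not concern the augmentation \<open>M 0\<close>.
\<close>

definition minimal_graded_free_resolution ::
    "('x::finite, 'k::field) mpoly set \<Rightarrow> (nat \<Rightarrow> nat list) \<Rightarrow> (nat \<Rightarrow> ('x, 'k) mpoly mat) \<Rightarrow> bool" where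
  "minimal_graded_free_resolution I d M \<longleftrightarrow> graded_free_resolution I d M \<and>
     (\<forall>i. elements_mat (M (Suc i)) \<subseteq> ideal_gen (range Var))"

text \<open>
  The minimal graded free resolution exists and is unique up to isomorphism, so its linearity may be
  tested on any one choice.
\<close>

definition has_linear_resolution :: "nat \<Rightarrow> ('x::finite, 'k::field) mpoly set \<Rightarrow> bool" where
  "has_linear_resolution q I \<longleftrightarrow>
     (\<exists>d M. minimal_graded_free_resolution I d M \<and> (\<forall>i. \<forall>a\<in>set (d i). a = i + q))"

end

theory Submission
  imports Defs
begin

text \<open>
  If \<open>f\<^sub>1, f\<^sub>2, f\<^sub>3\<close> had no linear syzygy, then the map \<open>F 1 \<rightarrow> F 0\<close> of the linear resolution would
  vanish, contradicting the Koszul relation \<open>f\<^sub>2 f\<^sub>1 - f\<^sub>1 f\<^sub>2 = 0\<close>.  A linear syzygy is a cycle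
  in the graph whose vertices are the monomials of degree 3 and whose edges are
  \<open>x u -- x v\<close> for a variable \<open>x\<close> and a generator \<open>u - v\<close>.  Since \<open>I\<close> is prime and contains no
  linear form, \<open>x u\<close> and \<open>y u\<close> are congruent modulo \<open>I\<close> only if \<open>x = y\<close>; so every generator
  labels at most one edge of a connected component, and the cycle is a triangle with edges
  \<open>x f\<close>, \<open>y g\<close>, \<open>z h\<close>.  By coprimality of \<open>u\<close> and \<open>v\<close>, the variables \<open>x, y, z\<close> are distinct, and
  comparing the vertices gives, up to sign, \<open>f = z p - y q\<close>, \<open>g = x q - z r\<close>, \<open>h = y r - x p\<close>,
  the minors of the matrix with rows \<open>(x, y, z)\<close> and \<open>(r, p, q)\<close>.
\<close>

abbreviation coef :: "('a \<Rightarrow>\<^sub>0 'b::zero) \<Rightarrow> 'a \<Rightarrow> 'b" where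
  "coef \<equiv> Poly_Mapping.lookup"

abbreviation supp :: "('a \<Rightarrow>\<^sub>0 'b::zero) \<Rightarrow> 'a set" where
  "supp \<equiv> Poly_Mapping.keys"

abbreviation mvar :: "'x \<Rightarrow> 'x monomial" where
  "mvar x \<equiv> Poly_Mapping.single x 1"

abbreviation const :: "'k::zero \<Rightarrow> ('x, 'k) mpoly" where
  "const \<equiv> Poly_Mapping.single 0"

section \<open>Ideals\<close>

lemma class_ring_ring: "ring (class_ring :: 'a::comm_ring_1 ring)"
  by (rule class_ring.ring_axioms)

text \<open>Negatives come from \<open>- a = (-1) * a\<close>, so closure under sums and multiples
  yields the additive subgroup.\<close>

lemma ideal_class_ring_iff:
  fixes J :: "'a::comm_ring_1 set"
  shows "ideal J class_ring \<longleftrightarrow>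
    0 \<in> J \<and> (\<forall>a\<in>J. \<forall>b\<in>J. a + b \<in> J) \<and> (\<forall>a\<in>J. \<forall>r. r * a \<in> J)" (is "?L = ?R")
proof
  assume L: ?L
  interpret ideal J class_ring by (rule L)
  show ?R
    using zero_closed a_closed I_l_closed by simp
next
  assume R: ?R
  show ?L
  proof (rule idealI[OF class_ring_ring])
    have "- a \<in> J" if "a \<in> J" for a
      using R that by (metis mult_minus1)
    moreover have "inv\<^bsub>add_monoid class_ring\<^esub> a = - a" for a :: 'a
    proof -
      have "a_inv (class_ring :: 'a ring) = uminus" by (rule class_ring_simps)
      then show ?thesis unfolding a_inv_def by (rule fun_cong)
    qed
    ultimately show "subgroup J (add_monoid (class_ring :: 'a ring))"
      using R by (unfold_locales) auto
  qed (use R in \<open>auto simp: mult.commute\<close>)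
qed

lemma ideal_class_ringD:
  fixes J :: "'a::comm_ring_1 set"
  assumes "ideal J class_ring"
  shows "0 \<in> J" "a \<in> J \<Longrightarrow> b \<in> J \<Longrightarrow> a + b \<in> J" "a \<in> J \<Longrightarrow> r * a \<in> J"
    "a \<in> J \<Longrightarrow> - a \<in> J"
proof -
  note * = assms[unfolded ideal_class_ring_iff]
  show "0 \<in> J" "a \<in> J \<Longrightarrow> b \<in> J \<Longrightarrow> a + b \<in> J" "a \<in> J \<Longrightarrow> r * a \<in> J"
    using * by auto
  show "a \<in> J \<Longrightarrow> - a \<in> J"
    using * by (metis mult_minus1)
qed

lemma ideal_class_ring_sum:
  fixes J :: "'a::comm_ring_1 set"
  assumes "ideal J class_ring" "\<And>i. i \<in> A \<Longrightarrow> f i \<in> J"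
  shows "(\<Sum>i\<in>A. f i) \<in> J"
  using assms(2) by (induction A rule: infinite_finite_induct)
    (auto intro: ideal_class_ringD[OF assms(1)])

lemma ideal_ideal_gen: "ideal (ideal_gen G) class_ring"
  unfolding ideal_gen_def by (rule ring.genideal_ideal[OF class_ring_ring]) simp

lemma subset_ideal_gen: "G \<subseteq> ideal_gen G"
  unfolding ideal_gen_def genideal_def by blast

lemma ideal_gen_minimal: "ideal J class_ring \<Longrightarrow> G \<subseteq> J \<Longrightarrow> ideal_gen G \<subseteq> J"
  unfolding ideal_gen_def genideal_def by blast

lemma ideal_gen_eqI:
  assumes "G \<subseteq> ideal_gen H" "H \<subseteq> ideal_gen G"
  shows "ideal_gen G = ideal_gen H"
  using assms by (intro equalityI ideal_gen_minimal ideal_ideal_gen)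

lemma ideal_gen_finite:
  assumes "finite G" "F \<in> ideal_gen G"
  shows "\<exists>h. F = (\<Sum>f\<in>G. h f * f)"
proof -
  \<comment> \<open>These combinations form an ideal containing \<open>G\<close>. Finiteness matters
    for \<open>G \<subseteq> ?J\<close>, as a sum over an infinite set is 0 by convention.\<close>
  let ?J = "{F. \<exists>h. F = (\<Sum>f\<in>G. h f * f)}"
  have "ideal ?J class_ring"
    unfolding ideal_class_ring_iff
  proof (intro conjI ballI allI)
    show "0 \<in> ?J" by (auto intro: exI[of _ "\<lambda>_. 0"])
    fix a b r assume "a \<in> ?J"
    then obtain h where a: "a = (\<Sum>f\<in>G. h f * f)" by auto
    have "r * a = (\<Sum>f\<in>G. (r * h f) * f)"
      unfolding a by (simp add: sum_distrib_left mult.assoc)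
    then show "r * a \<in> ?J" by (intro CollectI exI)
    assume "b \<in> ?J"
    then obtain h' where b: "b = (\<Sum>f\<in>G. h' f * f)" by auto
    have "a + b = (\<Sum>f\<in>G. (h f + h' f) * f)"
      unfolding a b by (simp add: sum.distrib distrib_right)
    then show "a + b \<in> ?J" by (intro CollectI exI)
  qed
  moreover have "G \<subseteq> ?J"
  proof
    fix g assume "g \<in> G"
    then have "g = (\<Sum>f\<in>G. (if f = g then 1 else 0) * f)"
      using assms(1) by (simp add: if_distrib[of "\<lambda>c. c * _"] sum.delta cong: if_cong)
    then show "g \<in> ?J" by (intro CollectI exI)
  qed
  ultimately show ?thesis
    using ideal_gen_minimal[of ?J G] assms(2) by blast
qed


section \<open>Degrees\<close>

lemma mdeg_add: "mdeg (u + v) = mdeg u + mdeg v"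
  by (simp add: mdeg_def lookup_add sum.distrib)

lemma mdeg_zero [simp]: "mdeg 0 = 0"
  by (simp add: mdeg_def)

lemma mdeg_single [simp]: "mdeg (Poly_Mapping.single x n) = n"
  by (simp add: mdeg_def lookup_single when_def)

lemma mdeg_eq_0_iff [simp]: "mdeg u = 0 \<longleftrightarrow> u = 0"
  by (simp add: mdeg_def poly_mapping_eq_iff fun_eq_iff)

lemma mvar_le_split:
  assumes "coef u x \<noteq> (0::nat)"
  obtains v where "u = mvar x + v"
proof
  show "u = mvar x + (u - mvar x)"
    using assms by (intro poly_mapping_eqI) (auto simp: lookup_add lookup_minus lookup_single when_def)
qed

lemma mdeg_Suc_split:
  assumes "mdeg u = Suc n"
  obtains x v where "u = mvar x + v" "mdeg v = n"
proof -
  have "u \<noteq> 0" using assms by auto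
  then obtain x where "coef u x \<noteq> 0"
    by (auto simp: poly_mapping_eq_iff fun_eq_iff)
  then obtain v where v: "u = mvar x + v" by (rule mvar_le_split)
  with assms have "mdeg v = n" by (simp add: mdeg_add)
  with v show thesis by (rule that)
qed

lemma mdeg_1_mvar:
  assumes "mdeg u = 1"
  obtains x where "u = mvar x"
  using mdeg_Suc_split[of u 0] assms by auto

lemma mvar_add_eq_split:
  assumes "mvar x + a = mvar y + b" "x \<noteq> y"
  obtains s where "a = mvar y + s" "b = mvar x + s"
proof -
  have "coef a y \<noteq> 0"
    using arg_cong[OF assms(1), of "\<lambda>u. coef u y"] assms(2)
    by (simp add: lookup_add lookup_single when_def)
  then obtain s where s: "a = mvar y + s" by (rule mvar_le_split)
  then have "mvar y + b = mvar y + (mvar x + s)"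
    using assms(1) by (simp only: add.left_commute)
  then have "b = mvar x + s" by (rule add_left_imp_eq)
  with s show thesis by (rule that)
qed

lemma mmonom_add: "mmonom (u + v) = mmonom u * mmonom v"
  by (simp add: mmonom_def mult_single)

lemma mmonom_mvar: "mmonom (mvar x) = Var x"
  by (simp add: Var_def)

text \<open>The \<open>n\<close>-th power of the ideal of the variables, described by monomials;
  \<open>n = 0\<close> gives the whole ring.\<close>

definition order_ge :: "nat \<Rightarrow> ('x::finite, 'k::field) mpoly set" where
  "order_ge n = {f. \<forall>u\<in>supp f. n \<le> mdeg u}"

lemma order_ge_mult:
  assumes "f \<in> order_ge m" "g \<in> order_ge n"
  shows "f * g \<in> order_ge (m + n)"
  unfolding order_ge_def
proof (intro CollectI ballI)
  fix u assume "u \<in> supp (f * g)"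
  then obtain a b where "u = a + b" "a \<in> supp f" "b \<in> supp g"
    using keys_mult[of f g] by blast
  then show "m + n \<le> mdeg u"
    using assms by (auto simp: order_ge_def mdeg_add intro: add_mono)
qed

lemma ideal_order_ge: "ideal (order_ge n) class_ring"
proof -
  have "r * a \<in> order_ge n" if "a \<in> order_ge n" for r a :: "('a, 'b) mpoly"
    using order_ge_mult[of r 0 a n] that by (simp add: order_ge_def)
  moreover have "a + b \<in> order_ge n" if "a \<in> order_ge n" "b \<in> order_ge n" for a b :: "('a, 'b) mpoly"
    using that Poly_Mapping.keys_add[of a b] unfolding order_ge_def by blast
  moreover have "(0 :: ('a, 'b) mpoly) \<in> order_ge n"
    by (simp add: order_ge_def)
  ultimately show ?thesis
    unfolding ideal_class_ring_iff by blast
qed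

text \<open>Replacing each coefficient by its constant term changes the sum only in degrees above
  \<open>n\<close>. Since both sides are homogeneous of degree \<open>n\<close>, nothing
  changes.\<close>

lemma homogeneous_combination:
  fixes F :: "('x::finite, 'k::field) mpoly"
  assumes F: "\<forall>u\<in>supp F. mdeg u = n" and g: "\<And>i. i \<in> A \<Longrightarrow> \<forall>u\<in>supp (g i). mdeg u = n"
    and eq: "F = (\<Sum>i\<in>A. h i * g i)"
  shows "F = (\<Sum>i\<in>A. const (coef (h i) 0) * g i)"
proof -
  let ?D = "F - (\<Sum>i\<in>A. const (coef (h i) 0) * g i)"
  have "?D = (\<Sum>i\<in>A. (h i - const (coef (h i) 0)) * g i)"
    unfolding left_diff_distrib sum_subtractf by (subst eq) (rule refl)
  moreover have "(h i - const (coef (h i) 0)) * g i \<in> order_ge (1 + n)" if "i \<in> A" for i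
  proof (rule order_ge_mult)
    have "mdeg u \<noteq> 0" if "u \<in> supp (h i - const (coef (h i) 0))" for u
      using that by (auto simp: in_keys_iff lookup_minus)
    then show "h i - const (coef (h i) 0) \<in> order_ge 1"
      unfolding order_ge_def by (auto simp: Suc_le_eq simp del: mdeg_eq_0_iff)
    show "g i \<in> order_ge n" using g[OF that] by (simp add: order_ge_def)
  qed
  ultimately have high: "?D \<in> order_ge (1 + n)"
    by (simp only: ideal_class_ring_sum[OF ideal_order_ge])
  have "supp ?D \<subseteq> {u. mdeg u = n}"
  proof -
    have "supp (const c * g i) \<subseteq> {u. mdeg u = n}" if "i \<in> A" for c i
      using keys_mult[of "const c" "g i"] g[OF that] by (auto split: if_splits)
    then have "supp (\<Sum>i\<in>A. const (coef (h i) 0) * g i) \<subseteq> {u. mdeg u = n}"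
      using keys_sum[of "\<lambda>i. const (coef (h i) 0) * g i" A] by blast
    then show ?thesis using F keys_diff[of F "\<Sum>i\<in>A. const (coef (h i) 0) * g i"] by blast
  qed
  with high have "False" if "u \<in> supp ?D" for u
    using that unfolding order_ge_def by force
  then have "supp ?D = {}" by blast
  then show ?thesis unfolding keys_eq_empty by (rule eq_iff_diff_eq_0[THEN iffD2])
qed

lemma mem_keys_mult_mmonom:
  assumes "m \<in> supp (l * mmonom u)"
  obtains k where "k \<in> supp l" "m = k + u"
  using assms keys_mult[of l "mmonom u"] by (auto simp: mmonom_def)

text \<open>Multiplication by a monomial shifts exponents injectively, so no other term of
  \<open>l\<close> lands on \<open>k + u\<close>.\<close>

lemma coef_mult_mmonom: "coef (l * mmonom u) (k + u) = coef (l :: ('x, 'k::field) mpoly) k"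
proof -
  have "coef (l * mmonom u) (k + u) =
     (\<Sum>a\<in>supp l. coef l a when a = k)"
  proof -
    have l: "l = (\<Sum>a\<in>supp l. Poly_Mapping.single a (coef l a))"
      by (rule poly_mapping_eqI)
        (simp add: lookup_sum lookup_single when_def sum.delta in_keys_iff)
    have "l * mmonom u = (\<Sum>a\<in>supp l. Poly_Mapping.single a (coef l a)) * mmonom u"
      using l by (rule arg_cong)
    also have "\<dots> = (\<Sum>a\<in>supp l. Poly_Mapping.single (a + u) (coef l a))"
      by (simp add: sum_distrib_right mmonom_def mult_single)
    finally have "l * mmonom u = (\<Sum>a\<in>supp l. Poly_Mapping.single (a + u) (coef l a))" .
    then show ?thesis
      by (simp add: lookup_sum lookup_single when_def)
  qed
  also have "\<dots> = coef l k" by (simp add: when_def sum.delta in_keys_iff)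
  finally show ?thesis .
qed

section \<open>Triangles of linear syzygies\<close>

text \<open>
  A generator \<open>f = u - v\<close> is encoded by its two monomials \<open>e f True = u\<close> and \<open>e f False = v\<close>,
  so that reversing the sign of \<open>f\<close> amounts to negating the Boolean.
\<close>

locale binomial_prime =
  fixes I G :: "('x::finite, 'k::field) mpoly set" and e :: "('x, 'k) mpoly \<Rightarrow> bool \<Rightarrow> 'x monomial"
  assumes card_G: "card G = 3"
    and e_neq: "f \<in> G \<Longrightarrow> e f True \<noteq> e f False"
    and mdeg_e: "f \<in> G \<Longrightarrow> mdeg (e f b) = 2"
    and f_eq: "f \<in> G \<Longrightarrow> f = mmonom (e f True) - mmonom (e f False)"
    and gens: "minimal_generating_set G I"
    and prime: "primeideal I class_ring"
begin

section \<open>Degrees and minimality of the generators\<close>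

lemma finite_G: "finite G"
  using card_G by (metis card.infinite zero_neq_numeral)

lemma I_eq: "I = ideal_gen G"
  using gens by (simp add: minimal_generating_set_def)

lemma ideal_I: "ideal I class_ring"
  unfolding I_eq by (rule ideal_ideal_gen)

lemma prime_I: "a * b \<in> I \<Longrightarrow> a \<in> I \<or> b \<in> I"
  using primeideal.I_prime[OF prime, of a b] by simp

lemma G_subset_I: "G \<subseteq> I"
  unfolding I_eq by (rule subset_ideal_gen)

lemma homogeneous_G:
  assumes "f \<in> G"
  shows "\<forall>u\<in>supp f. mdeg u = 2"
proof
  fix u assume "u \<in> supp f"
  then have "u \<in> supp (mmonom (e f True) - mmonom (e f False) :: ('x, 'k) mpoly)"
    using f_eq[OF assms] by simp
  then have "u = e f True \<or> u = e f False"
    by (auto simp: in_keys_iff lookup_minus mmonom_def lookup_single when_def split: if_splits)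
  then show "mdeg u = 2" using mdeg_e[OF assms] by metis
qed

lemma I_subset_order_ge_2: "I \<subseteq> order_ge 2"
  unfolding I_eq
proof (rule ideal_gen_minimal[OF ideal_order_ge])
  show "G \<subseteq> order_ge 2"
    using homogeneous_G by (simp add: order_ge_def subset_iff)
qed

lemma generator_notin:
  assumes "f \<in> G"
  shows "f \<notin> ideal_gen (G - {f})"
proof
  assume "f \<in> ideal_gen (G - {f})"
  then have "G \<subseteq> ideal_gen (G - {f})"
    using subset_ideal_gen[of "G - {f}"] by blast
  moreover have "G - {f} \<subseteq> ideal_gen G"
    using subset_ideal_gen[of G] by blast
  ultimately have "ideal_gen (G - {f}) = I"
    unfolding I_eq by (intro ideal_gen_eqI)
  moreover have "G - {f} \<subset> G" using assms by blast
  ultimately show False using gens unfolding minimal_generating_set_def by blast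
qed

text \<open>Dividing by a nonzero coefficient \<open>c g\<close> would put \<open>g\<close> into the
  ideal of the other generators. This makes scalar coordinates with respect to \<open>G\<close>
  unique.\<close>

lemma independent:
  assumes zero: "(\<Sum>f\<in>G. const (c f) * f) = 0" and g: "g \<in> G"
  shows "c g = 0"
proof (rule ccontr)
  assume c: "c g \<noteq> 0"
  let ?J = "ideal_gen (G - {g})"
  note J = ideal_class_ringD[OF ideal_ideal_gen]
  have "const (c g) * g = - (\<Sum>f\<in>G - {g}. const (c f) * f)"
    using zero sum.remove[OF finite_G g, of "\<lambda>f. const (c f) * f"] by (simp add: eq_neg_iff_add_eq_0)
  also have "\<dots> \<in> ?J"
    using subset_ideal_gen[of "G - {g}"]
    by (intro J(4) ideal_class_ring_sum[OF ideal_ideal_gen] J(3)) blast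
  finally have "const (inverse (c g)) * (const (c g) * g) \<in> ?J"
    by (rule J(3))
  moreover have "const (inverse (c g)) * (const (c g) * g) = g"
    using c by (simp add: mult.assoc[symmetric] mult_single)
  ultimately show False using generator_notin[OF g] by simp
qed

section \<open>Fibres: congruence classes of monomials modulo the prime ideal\<close>

definition same_fibre :: "'x monomial \<Rightarrow> 'x monomial \<Rightarrow> bool" where
  "same_fibre m n \<longleftrightarrow> (mmonom m - mmonom n :: ('x, 'k) mpoly) \<in> I"

lemma same_fibre_refl: "same_fibre m m"
  using ideal_class_ringD(1)[OF ideal_I] by (simp add: same_fibre_def)

lemma same_fibre_sym: "same_fibre m n \<Longrightarrow> same_fibre n m"
  using ideal_class_ringD(4)[OF ideal_I] by (metis same_fibre_def minus_diff_eq)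

lemma same_fibre_trans: "same_fibre m n \<Longrightarrow> same_fibre n r \<Longrightarrow> same_fibre m r"
  using ideal_class_ringD(2)[OF ideal_I, of "mmonom m - mmonom n" "mmonom n - mmonom r"]
  by (simp add: same_fibre_def)

lemma same_fibre_add: "same_fibre m n \<Longrightarrow> same_fibre (k + m) (k + n)"
  using ideal_class_ringD(3)[OF ideal_I, of "mmonom m - mmonom n" "mmonom k"]
  by (simp add: same_fibre_def mmonom_add right_diff_distrib)

text \<open>A prime ideal containing a monomial contains 1 or a variable, but every element of
  \<open>I\<close> has order at least 2.\<close>

lemma mmonom_notin_I: "(mmonom m :: ('x, 'k) mpoly) \<notin> I"
proof (induction "mdeg m" arbitrary: m)
  case 0
  then show ?case using I_subset_order_ge_2 by (auto simp: order_ge_def mmonom_def)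
next
  case (Suc n)
  then obtain x v where v: "m = mvar x + v" "mdeg v = n"
    by (metis mdeg_Suc_split)
  have "(mmonom (mvar x) :: ('x, 'k) mpoly) \<notin> I"
    using I_subset_order_ge_2 by (auto simp: order_ge_def mmonom_def)
  then show ?case using Suc(1)[of v] v prime_I by (auto simp: mmonom_add)
qed

text \<open>The difference factors as \<open>mmonom k\<close> times a binomial, and the prime ideal
  does not contain \<open>mmonom k\<close>.\<close>

lemma same_fibre_cancel: "same_fibre (k + m) (k + n) \<Longrightarrow> same_fibre m n"
  using prime_I[of "mmonom k" "mmonom m - mmonom n"] mmonom_notin_I[of k]
  by (simp add: same_fibre_def mmonom_add right_diff_distrib)

lemma same_fibre_low_degree:
  assumes "same_fibre m n" "mdeg m < 2"
  shows "m = n"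
proof (rule ccontr)
  assume "m \<noteq> n"
  then have "m \<in> supp (mmonom m - mmonom n :: ('x, 'k) mpoly)"
    by (simp add: in_keys_iff lookup_minus mmonom_def lookup_single)
  then show False
    using assms I_subset_order_ge_2 by (fastforce simp: order_ge_def same_fibre_def)
qed

lemma same_fibre_e: "f \<in> G \<Longrightarrow> same_fibre (e f b) (e f c)"
proof -
  assume f: "f \<in> G"
  then have *: "same_fibre (e f True) (e f False)"
    unfolding same_fibre_def using G_subset_I f_eq[OF f] by auto
  show ?thesis
    by (cases b; cases c) (auto intro: * same_fibre_refl same_fibre_sym[OF *])
qed

lemma e_inj: "f \<in> G \<Longrightarrow> e f b = e f c \<longleftrightarrow> b = c"
  using e_neq[of f] by (cases b; cases c) auto

text \<open>Exchanging \<open>e f c\<close> for the congruent \<open>e f b\<close> and cancelling it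
  leaves two congruent variables, which must be equal. Thus two edges with label \<open>f\<close> in
  one fibre coincide.\<close>

lemma generator_once_in_fibre:
  assumes "f \<in> G" "same_fibre (mvar x + e f b) (mvar y + e f c)"
  shows "x = y"
proof -
  have "same_fibre (mvar x + e f b) (mvar y + e f b)"
    using same_fibre_trans[OF assms(2) same_fibre_add[OF same_fibre_e[OF assms(1)]]] .
  then have "same_fibre (mvar x) (mvar y)"
    using same_fibre_cancel[of "e f b"] by (simp add: add.commute)
  then have "mvar x = mvar y" by (rule same_fibre_low_degree) simp
  then show ?thesis
    by (metis lookup_single_eq lookup_single_not_eq zero_neq_one)
qed

text \<open>Cancelling the common variable would leave congruent monomials of degree 1; these are
  equal, so the two monomials of \<open>f\<close> would agree.\<close>

lemma monomials_coprime:
  assumes f: "f \<in> G" and "e f b = mvar x + s" "e f (\<not> b) = mvar x + t"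
  shows False
proof -
  have "same_fibre s t"
    using same_fibre_e[OF f, of b "\<not> b"] assms(2,3) same_fibre_cancel by simp
  moreover have "mdeg s = 1"
    using mdeg_e[OF f, of b] assms(2) by (simp add: mdeg_add)
  ultimately have "s = t" by (intro same_fibre_low_degree) auto
  then show False using assms(2,3) e_inj[OF f, of b "\<not> b"] by simp
qed

section \<open>Orientations, double edges and triangles\<close>

lemma generator_mem_iff:
  assumes J: "ideal J class_ring" and f: "f \<in> G"
  shows "f \<in> J \<longleftrightarrow> mmonom (e f b) - mmonom (e f (\<not> b)) \<in> J"
proof (cases b)
  case True
  then show ?thesis using f_eq[OF f] by simp
next
  case False
  then have "mmonom (e f b) - mmonom (e f (\<not> b)) = - f"
    using arg_cong[OF f_eq[OF f], of uminus] by (simp only: minus_diff_eq) simp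
  then show ?thesis using ideal_class_ringD(4)[OF J] by (metis minus_minus)
qed

text \<open>If \<open>x = y\<close>, cancelling gives \<open>f = g\<close> up to sign, against
  minimality. Otherwise \<open>y\<close> divides both monomials of \<open>f\<close>, against
  coprimality.\<close>

lemma no_double_edge:
  assumes "f \<in> G" "g \<in> G" "f \<noteq> g"
    and eq: "mvar x + e f b = mvar y + e g c" "mvar x + e f (\<not> b) = mvar y + e g (\<not> c)"
  shows False
proof (cases "x = y")
  case True
  have "g \<in> ideal_gen (G - {f})"
    using assms(2,3) subset_ideal_gen[of "G - {f}"] by auto
  then have "f \<in> ideal_gen (G - {f})"
    using eq True
      generator_mem_iff[OF ideal_ideal_gen assms(1), of "G - {f}" b]
      generator_mem_iff[OF ideal_ideal_gen assms(2), of "G - {f}" c]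
    by simp
  then show False using generator_notin[OF assms(1)] by blast
next
  case False
  obtain s where "e f b = mvar y + s" using mvar_add_eq_split[OF eq(1) False] .
  moreover obtain t where "e f (\<not> b) = mvar y + t" using mvar_add_eq_split[OF eq(2) False] .
  ultimately show False using monomials_coprime[OF assms(1)] by blast
qed

text \<open>The closed walk starts at the vertex \<open>mvar x + e f b\<close> and runs along
  \<open>f\<close>, \<open>g\<close>, \<open>h\<close> in turn. The Booleans \<open>b\<close>,
  \<open>c\<close>, \<open>d\<close> mark the end at which each edge is entered.\<close>

definition triangle where
  "triangle x f b y g c z h d \<longleftrightarrow> f \<in> G \<and> g \<in> G \<and> h \<in> G \<and> distinct [f, g, h] \<and>
     mvar x + e f (\<not> b) = mvar y + e g c \<and>
     mvar y + e g (\<not> c) = mvar z + e h d \<and>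
     mvar z + e h (\<not> d) = mvar x + e f b"

lemma triangle_rotate: "triangle x f b y g c z h d \<Longrightarrow> triangle y g c z h d x f b"
  by (auto simp: triangle_def)

lemma triangle_neq:
  assumes T: "triangle x f b y g c z h d"
  shows "x \<noteq> y"
proof
  assume "x = y"
  then have 1: "e f (\<not> b) = e g c"
    and 2: "mvar x + e g (\<not> c) = mvar z + e h d" and 3: "mvar x + e f b = mvar z + e h (\<not> d)"
    and G: "f \<in> G" "g \<in> G" "h \<in> G" "f \<noteq> g" "f \<noteq> h"
    using T by (auto simp: triangle_def)
  show False
  proof (cases "x = z")
    \<comment> \<open>With all three multipliers equal, the oriented binomials sum to zero around
      the triangle, so \<open>f\<close> lies in the ideal of \<open>g\<close> and
      \<open>h\<close>.\<close>
    case True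
    let ?J = "ideal_gen (G - {f})"
    note J = ideal_class_ringD[OF ideal_ideal_gen[of "G - {f}"]]
    have "g \<in> ?J" "h \<in> ?J"
      using G subset_ideal_gen[of "G - {f}"] by auto
    then have "mmonom (e g c) - mmonom (e g (\<not> c)) \<in> ?J" "mmonom (e h d) - mmonom (e h (\<not> d)) \<in> ?J"
      using generator_mem_iff[OF ideal_ideal_gen G(2)] generator_mem_iff[OF ideal_ideal_gen G(3)]
      by blast+
    from J(4)[OF J(2)[OF this]] have "mmonom (e f b) - mmonom (e f (\<not> b)) \<in> ?J"
      using 1 2 3 True by simp
    then show False
      using generator_mem_iff[OF ideal_ideal_gen G(1)] generator_notin[OF G(1)] by blast
  next
    \<comment> \<open>Here \<open>x\<close> divides both monomials of \<open>h\<close>.\<close>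
    case False
    obtain s where "e h d = mvar x + s" using mvar_add_eq_split[OF 2 False] .
    moreover obtain t where "e h (\<not> d) = mvar x + t" using mvar_add_eq_split[OF 3 False] .
    ultimately show False using monomials_coprime[OF G(3)] by blast
  qed
qed

text \<open>The coefficient of the syzygy at the vertex \<open>mvar x + e f b\<close> is zero, so
  the contribution of the edge \<open>x f\<close> must be cancelled by an edge with another
  label.\<close>

lemma syzygy_neighbour:
  assumes syz: "(\<Sum>f\<in>G. l f * f) = 0"
    and deg: "\<And>f k. f \<in> G \<Longrightarrow> k \<in> supp (l f) \<Longrightarrow> mdeg k = 1"
    and f: "f \<in> G" "mvar x \<in> supp (l f)"
  obtains y g c where "g \<in> G" "g \<noteq> f" "mvar y \<in> supp (l g)" "mvar x + e f b = mvar y + e g c"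
proof (rule ccontr)
  note found = that
  assume *: "\<not> thesis"
  let ?m = "mvar x + e f b"
  \<comment> \<open>The contribution of the monomial \<open>e g c\<close> at the vertex
    \<open>?m\<close>. Without the desired neighbour, only \<open>t f b\<close> can be
    nonzero.\<close>
  define t where "t g c = coef (l g * mmonom (e g c)) ?m" for g c
  have t_zero: "t g c = 0" if g: "g \<in> G" and "g \<noteq> f \<or> c \<noteq> b" for g c
  proof (rule ccontr)
    assume "t g c \<noteq> 0"
    then have "?m \<in> supp (l g * mmonom (e g c))" by (simp add: t_def in_keys_iff)
    then obtain k where k: "k \<in> supp (l g)" "?m = k + e g c"
      by (rule mem_keys_mult_mmonom)
    obtain y where y: "k = mvar y" using mdeg_1_mvar[OF deg[OF g k(1)]] .
    with k have y: "mvar y \<in> supp (l g)" "?m = mvar y + e g c" by simp_all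
    then have "g = f" using * found[OF g] by blast
    moreover from this have "x = y"
      using generator_once_in_fibre[OF f(1), of x b y c] y(2) same_fibre_refl by simp
    ultimately have "c = b" using y(2) e_inj[OF f(1), of b c] by simp
    with \<open>g = f\<close> that(2) show False by simp
  qed
  have "0 = coef (\<Sum>g\<in>G. l g * g) ?m" by (simp add: syz)
  also have "\<dots> = (\<Sum>g\<in>G. t g True - t g False)"
    unfolding lookup_sum
  proof (rule sum.cong[OF refl])
    fix g assume "g \<in> G"
    then have "l g * g = l g * (mmonom (e g True) - mmonom (e g False))"
      using arg_cong[OF f_eq] by blast
    then show "coef (l g * g) ?m = t g True - t g False"
      by (simp add: t_def right_diff_distrib lookup_minus)
  qed
  also have "\<dots> = t f True - t f False"
    using t_zero by (subst sum.remove[OF finite_G f(1)]) (simp add: sum.neutral)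
  finally have "t f b = 0"
    using t_zero[OF f(1), of "\<not> b"] by (cases b) auto
  moreover have "t f b = coef (l f) (mvar x)"
    unfolding t_def by (rule coef_mult_mmonom)
  ultimately show False using f(2) by (simp add: in_keys_iff)
qed

text \<open>
  No vertex meets exactly one edge in the support of the syzygy, so an edge extends at both ends,
  and the two new edges, having the two remaining labels, must meet.
\<close>

lemma triangle_of_linear_syzygy:
  assumes syz: "(\<Sum>f\<in>G. l f * f) = 0"
    and deg: "\<And>f k. f \<in> G \<Longrightarrow> k \<in> supp (l f) \<Longrightarrow> mdeg k = 1"
    and f: "f \<in> G" "l f \<noteq> 0"
  shows "\<exists>x f b y g c z h d. triangle x f b y g c z h d"
proof -
  have "supp (l f) \<noteq> {}" using f(2) by simp
  then obtain k where k: "k \<in> supp (l f)" by blast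
  obtain x where "k = mvar x" using mdeg_1_mvar[OF deg[OF f(1) k]] .
  with k have x: "mvar x \<in> supp (l f)" by simp
  have neighbour: "\<exists>y g c. g \<in> G \<and> g \<noteq> f \<and> mvar y \<in> supp (l g) \<and> mvar x + e f b = mvar y + e g c"
    if f: "f \<in> G" "mvar x \<in> supp (l f)" for f x b
  proof (rule syzygy_neighbour[where l = l and f = f and x = x and b = b])
    show "(\<Sum>f\<in>G. l f * f) = 0" by (rule syz)
    show "mdeg k = 1" if "f \<in> G" "k \<in> supp (l f)" for f k using deg that by blast
  qed (use f in blast)+
  obtain y g c where g: "g \<in> G" "g \<noteq> f" "mvar y \<in> supp (l g)"
    and xy: "mvar x + e f False = mvar y + e g c"
    using neighbour[OF f(1) x] by blast
  obtain z h d where h: "h \<in> G" "h \<noteq> f" "mvar z \<in> supp (l h)"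
    and xz: "mvar x + e f True = mvar z + e h d"
    using neighbour[OF f(1) x] by blast
  \<comment> \<open>The three edges share vertices and hence lie in one fibre, where each label
    determines its multiplier.\<close>
  have fib_f: "same_fibre (mvar x + e f b) (mvar x + e f b')" for b b'
    by (intro same_fibre_add same_fibre_e f)
  have fib_g: "same_fibre (mvar y + e g b) (mvar x + e f b')" for b b'
    using same_fibre_trans[OF same_fibre_add[OF same_fibre_e[OF g(1), of b c]]]
      fib_f[of False b'] xy by metis
  have fib_h: "same_fibre (mvar z + e h b) (mvar x + e f b')" for b b'
    using same_fibre_trans[OF same_fibre_add[OF same_fibre_e[OF h(1), of b d]]]
      fib_f[of True b'] xz by metis
  \<comment> \<open>Equal labels would force \<open>z = y\<close>, so both neighbours would be the
    same edge, running parallel to \<open>x f\<close>.\<close>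
  have "h \<noteq> g"
  proof
    assume "h = g"
    then have "z = y"
      using generator_once_in_fibre[OF g(1), of z c y c]
        same_fibre_trans[OF fib_h[of c True] same_fibre_sym[OF fib_g[of c True]]] by simp
    have "d \<noteq> c"
    proof
      assume "d = c"
      then have "mvar x + e f False = mvar x + e f True"
        unfolding xy xz \<open>h = g\<close> \<open>z = y\<close> by simp
      then show False using e_inj[OF f(1), of True False] by simp
    qed
    then have "d = (\<not> c)" by blast
    then show False
      using no_double_edge[OF f(1) g(1) g(2)[symmetric], of x False y c] xy xz \<open>h = g\<close> \<open>z = y\<close>
      by simp
  qed
  have G_eq: "G = {f, g, h}"
    using card_G f(1) g(1,2) h(1,2) \<open>h \<noteq> g\<close> finite_G
    by (intro card_seteq[symmetric]) (auto simp: card_insert_if)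
  \<comment> \<open>The walk continues from the free end of \<open>y g\<close>. Only the labels
    \<open>f\<close> and \<open>h\<close> remain, and returning along \<open>f\<close> would give a
    double edge or identify the two ends of \<open>y g\<close>.\<close>
  obtain w k b where k: "k \<in> G" "k \<noteq> g" and yw: "mvar y + e g (\<not> c) = mvar w + e k b"
    using neighbour[OF g(1,3)] by blast
  have "k \<noteq> f"
  proof
    assume "k = f"
    then have "w = x"
      using generator_once_in_fibre[OF f(1), of w b x b] fib_g[of "\<not> c" b] yw by simp
    then have yw': "mvar x + e f b = mvar y + e g (\<not> c)" using yw \<open>k = f\<close> by simp
    show False
    proof (cases b)
      case True
      then show False
        using no_double_edge[OF f(1) g(1) g(2)[symmetric], of x False y c] xy yw' by simp
    next
      case False
      then show False using xy yw' e_inj[OF g(1), of c "\<not> c"] by simp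
    qed
  qed
  with k G_eq have "k = h" by blast
  then have "w = z"
    using generator_once_in_fibre[OF h(1), of w b z b]
      same_fibre_trans[OF fib_g[of "\<not> c" True] same_fibre_sym[OF fib_h[of b True]]] yw by simp
  \<comment> \<open>If the edge \<open>z h\<close> met \<open>y g\<close> at the end already used by
    \<open>x f\<close>, then \<open>y g\<close> would be parallel to \<open>x f\<close>.\<close>
  have "b \<noteq> d"
  proof
    assume "b = d"
    then have "mvar x + e f True = mvar y + e g (\<not> c)"
      unfolding xz yw \<open>k = h\<close> \<open>w = z\<close> by simp
    then show False
      using no_double_edge[OF f(1) g(1) g(2)[symmetric], of x False y c] xy by simp
  qed
  then have "(\<not> b) = d" by blast
  then have "triangle x f True y g c z h b"
    unfolding triangle_def using f(1) g(1,2) h(1,2) \<open>h \<noteq> g\<close> xy xz yw \<open>k = h\<close> \<open>w = z\<close> by auto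
  then show ?thesis by blast
qed

section \<open>Reading the matrix off a triangle\<close>

lemma triangle_variables:
  assumes T: "triangle x f b y g c z h d"
  obtains p q r where
    "e f b = mvar z + mvar p" "e f (\<not> b) = mvar y + mvar q"
    "e g c = mvar x + mvar q" "e g (\<not> c) = mvar z + mvar r"
    "e h d = mvar y + mvar r" "e h (\<not> d) = mvar x + mvar p"
proof -
  have neq: "x \<noteq> y" "y \<noteq> z" "z \<noteq> x"
    using triangle_neq[OF T] triangle_neq[OF triangle_rotate[OF T]]
      triangle_neq[OF triangle_rotate[OF triangle_rotate[OF T]]] by simp_all
  have eq: "mvar x + e f (\<not> b) = mvar y + e g c" "mvar y + e g (\<not> c) = mvar z + e h d"
    "mvar z + e h (\<not> d) = mvar x + e f b" and G: "f \<in> G" "g \<in> G" "h \<in> G"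
    using T by (simp_all add: triangle_def)
  \<comment> \<open>As the multipliers differ, each divides the opposite monomial at a shared
    vertex, and the two monomials have the same cofactor. Degree 2 then makes the cofactors
    variables.\<close>
  obtain q where q: "e f (\<not> b) = mvar y + q" "e g c = mvar x + q"
    by (rule mvar_add_eq_split[OF eq(1) neq(1)])
  obtain r where r: "e g (\<not> c) = mvar z + r" "e h d = mvar y + r"
    by (rule mvar_add_eq_split[OF eq(2) neq(2)])
  obtain p where p: "e h (\<not> d) = mvar x + p" "e f b = mvar z + p"
    by (rule mvar_add_eq_split[OF eq(3) neq(3)])
  have "mdeg p = 1" "mdeg q = 1" "mdeg r = 1"
    using mdeg_e[OF G(1), of b] mdeg_e[OF G(2)] mdeg_e[OF G(3), of d] p q r
      mdeg_e[OF G(2), of c] by (simp_all add: mdeg_add)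
  then obtain p' q' r' where "p = mvar p'" "q = mvar q'" "r = mvar r'"
    by (metis mdeg_1_mvar)
  then show thesis using that p q r by blast
qed

lemma ideal_of_triangle:
  assumes T: "triangle x f b y g c z h d" and
    pqr: "e f b = mvar z + mvar p" "e f (\<not> b) = mvar y + mvar q"
    "e g c = mvar x + mvar q" "e g (\<not> c) = mvar z + mvar r"
    "e h d = mvar y + mvar r" "e h (\<not> d) = mvar x + mvar p"
  shows "I = ideal_gen {Var x * Var p - Var y * Var r, Var x * Var q - Var z * Var r,
    Var y * Var q - Var z * Var p}" (is "I = ideal_gen ?M")
proof -
  have G: "f \<in> G" "g \<in> G" "h \<in> G" "distinct [f, g, h]" using T by (simp_all add: triangle_def)
  then have G_eq: "G = {f, g, h}"
    using card_G finite_G by (intro card_seteq[symmetric]) (auto simp: card_insert_if)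
  \<comment> \<open>Each generator is oriented so that it is literally a minor of the matrix with
    rows \<open>(x, y, z)\<close> and \<open>(r, p, q)\<close>; the double negation matches
    \<open>generator_mem_iff\<close> at \<open>\<not> b\<close> and \<open>\<not> d\<close>.\<close>
  have M: "?M = {mmonom (e h (\<not> d)) - mmonom (e h (\<not> \<not> d)),
      mmonom (e g c) - mmonom (e g (\<not> c)), mmonom (e f (\<not> b)) - mmonom (e f (\<not> \<not> b))}"
    unfolding not_not pqr mmonom_add mmonom_mvar ..
  have mem: "f \<in> J \<and> g \<in> J \<and> h \<in> J \<longleftrightarrow> ?M \<subseteq> J" if J: "ideal J class_ring" for J
    unfolding M generator_mem_iff[OF J G(1), of "\<not> b"] generator_mem_iff[OF J G(2), of c]
      generator_mem_iff[OF J G(3), of "\<not> d"] by auto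
  show ?thesis
    unfolding I_eq
  proof (rule ideal_gen_eqI)
    show "G \<subseteq> ideal_gen ?M"
      using mem[OF ideal_ideal_gen, of ?M] subset_ideal_gen[of ?M] unfolding G_eq by blast
    show "?M \<subseteq> ideal_gen G"
      using mem[OF ideal_ideal_gen, of G] subset_ideal_gen[of G] G by blast
  qed
qed

lemma coprime_variables:
  assumes f: "f \<in> G" and "e f b = mvar s + mvar t" "e f (\<not> b) = mvar s' + mvar t'"
  shows "s \<noteq> s'" "s \<noteq> t'" "t \<noteq> s'" "t \<noteq> t'"
  using assms monomials_coprime[OF f, of b] by (metis add.commute)+

end

lemma squarefree_mvar_add:
  assumes "squarefree_monomial (mvar s + mvar t)"
  shows "s \<noteq> t"
proof
  assume "s = t"
  then have "coef (mvar s + mvar t) s = 2" by (simp add: lookup_add)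
  with assms show False by (metis squarefree_monomial_def Suc_1 not_less_eq_eq le_refl One_nat_def)
qed

context binomial_prime
begin

text \<open>In the matrix with columns \<open>(x, r)\<close>, \<open>(y, p)\<close>,
  \<open>(z, q)\<close>, coprimality separates the entries of each column and of the second row.
  Squarefreeness separates entries in different rows and columns, and \<open>triangle_neq\<close>
  separates the first row.\<close>

lemma triangle_variables_distinct:
  assumes T: "triangle x f b y g c z h d" and
    pqr: "e f b = mvar z + mvar p" "e f (\<not> b) = mvar y + mvar q"
    "e g c = mvar x + mvar q" "e g (\<not> c) = mvar z + mvar r"
    "e h d = mvar y + mvar r" "e h (\<not> d) = mvar x + mvar p"
    and sqf: "\<And>f b. f \<in> G \<Longrightarrow> squarefree_monomial (e f b)"
  shows "distinct [x, y, z, r, p, q]"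
proof -
  have G: "f \<in> G" "g \<in> G" "h \<in> G" using T by (simp_all add: triangle_def)
  have "x \<noteq> y" "y \<noteq> z" "z \<noteq> x"
    using triangle_neq[OF T] triangle_neq[OF triangle_rotate[OF T]]
      triangle_neq[OF triangle_rotate[OF triangle_rotate[OF T]]] by simp_all
  moreover note coprime_variables[OF G(1) pqr(1,2)] coprime_variables[OF G(2) pqr(3,4)]
    coprime_variables[OF G(3) pqr(5,6)]
  moreover have "z \<noteq> p" "y \<noteq> q" "x \<noteq> q" "z \<noteq> r" "y \<noteq> r" "x \<noteq> p"
    using sqf[OF G(1), of b] sqf[OF G(1), of "\<not> b"] sqf[OF G(2), of c] sqf[OF G(2), of "\<not> c"]
      sqf[OF G(3), of d] sqf[OF G(3), of "\<not> d"] unfolding pqr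
    by (blast dest: squarefree_mvar_add)+
  ultimately show ?thesis by auto
qed

end

section \<open>A linear syzygy\<close>

lemma const_sum: "const (\<Sum>i\<in>A. f i) = (\<Sum>i\<in>A. const (f i))"
  by (induction A rule: infinite_finite_induct) (simp_all add: single_add)

lemma keys_const_mult: "supp (const (c :: 'k::field) * f) \<subseteq> supp (f :: ('x, 'k) mpoly)"
  using keys_mult[of "const c" f] by (auto split: if_splits)

lemma mult_mat_vec_index:
  fixes A :: "'a::comm_ring_1 mat"
  assumes "A \<in> carrier_mat m n" "v \<in> carrier_vec n" "i < m"
  shows "(A *\<^sub>v v) $ i = (\<Sum>j<n. v $ j * A $$ (i, j))"
  using assms by (auto simp: scalar_prod_def mult.commute lessThan_atLeast0 intro!: sum.cong)

text \<open>The resolution may use other generators \<open>g j\<close> of \<open>I\<close>. Scalar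
  matrices translate between them and \<open>G\<close>, carrying the columns of
  \<open>M (Suc 0)\<close> to linear syzygies of \<open>G\<close>; the Koszul relation shows that
  not all of these vanish.\<close>

lemma (in binomial_prime) linear_syzygy:
  assumes "has_linear_resolution 2 I"
  shows "\<exists>l. (\<Sum>f\<in>G. l f * f) = 0 \<and> (\<forall>f\<in>G. \<forall>k\<in>supp (l f). mdeg k = 1) \<and> (\<exists>f\<in>G. l f \<noteq> 0)"
proof -
  obtain d and M :: "nat \<Rightarrow> ('x, 'k) mpoly mat" where
    res: "graded_free_resolution I d M" and lin: "\<And>i a. a \<in> set (d i) \<Longrightarrow> a = i + 2"
    using assms unfolding has_linear_resolution_def minimal_graded_free_resolution_def by blast
  define n N where "n = length (d 0)" and "N = length (d (Suc 0))"
  define g where "g j = M 0 $$ (0, j)" for j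
  define s where "s j i = M (Suc 0) $$ (j, i)" for j i
  have hom0: "graded_hom (d 0) [0] (M 0)" and hom1: "graded_hom (d (Suc 0)) (d 0) (M (Suc 0))"
    and aug: "(\<lambda>w. w $ 0) ` mat_image (M 0) = I"
    and exact: "mat_kernel (M 0) = mat_image (M (Suc 0))"
    using res unfolding graded_free_resolution_def by blast+
  have M0: "M 0 \<in> carrier_mat 1 n" and M1: "M (Suc 0) \<in> carrier_mat n N"
    using hom0 hom1 unfolding graded_hom_def n_def N_def by auto
  have d0: "d 0 ! j = 2" if "j < n" for j
    using lin[of "d 0 ! j" 0] that unfolding n_def by simp
  have d1: "d (Suc 0) ! i = 3" if "i < N" for i
    using lin[of "d (Suc 0) ! i" "Suc 0"] that unfolding N_def by simp
  have deg_g: "\<forall>u\<in>supp (g j). mdeg u = 2" if "j < n" for j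
    using hom0 that d0[OF that] unfolding graded_hom_def g_def n_def by simp
  have deg_s: "mdeg u = 1" if "j < n" "i < N" "u \<in> supp (s j i)" for j i u
  proof -
    have "mdeg u + d 0 ! j = d (Suc 0) ! i"
      using hom1 that unfolding graded_hom_def s_def n_def N_def by blast
    then show ?thesis using d0[OF that(1)] d1[OF that(2)] by simp
  qed
  have M0_mult: "(M 0 *\<^sub>v v) $ 0 = (\<Sum>j<n. v $ j * g j)" if "v \<in> carrier_vec n" for v
    unfolding g_def by (rule mult_mat_vec_index[OF M0 that]) simp
  have I_iff: "F \<in> I \<longleftrightarrow> (\<exists>v\<in>carrier_vec n. F = (\<Sum>j<n. v $ j * g j))" for F
  proof -
    have "I = (\<lambda>v. \<Sum>j<n. v $ j * g j) ` carrier_vec n"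
      unfolding aug[symmetric] mat_image_def image_image
      using M0 M0_mult by (intro image_cong) auto
    then show ?thesis by blast
  qed
  have g_I: "g j \<in> I" if "j < n" for j
    unfolding I_iff
  proof (rule bexI)
    show "g j = (\<Sum>i<n. vec n (\<lambda>i. if i = j then 1 else 0) $ i * g i)"
      using that by (simp add: if_distrib[of "\<lambda>c. c * _"] cong: if_cong)
  qed simp
  have b_ex: "\<exists>b. g j = (\<Sum>f\<in>G. const (b f) * f)" if j: "j < n" for j
  proof -
    obtain h where h: "g j = (\<Sum>f\<in>G. h f * f)"
      using ideal_gen_finite[OF finite_G, of "g j"] g_I[OF j] unfolding I_eq by blast
    have "g j = (\<Sum>f\<in>G. const (coef (h f) 0) * f)"
      using homogeneous_G by (rule homogeneous_combination[OF deg_g[OF j] _ h])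
    then show ?thesis by (rule exI[of _ "\<lambda>f. coef (h f) 0"])
  qed
  \<comment> \<open>Both families consist of forms of degree 2, so scalar coefficients suffice:
    \<open>b\<close> writes \<open>g j\<close> in terms of \<open>G\<close>, and \<open>c\<close>
    below writes \<open>f\<close> in terms of the \<open>g j\<close>.\<close>
  define b where "b j = (SOME b. g j = (\<Sum>f\<in>G. const (b f) * f))" for j
  have b: "g j = (\<Sum>f\<in>G. const (b j f) * f)" if "j < n" for j
    unfolding b_def by (rule someI_ex[OF b_ex[OF that]])
  have c_ex: "\<exists>c. f = (\<Sum>j<n. const (c j) * g j)" if f: "f \<in> G" for f
  proof -
    have "f \<in> I" using f G_subset_I by blast
    then obtain v where v: "f = (\<Sum>j<n. v $ j * g j)" unfolding I_iff by blast
    have "f = (\<Sum>j<n. const (coef (v $ j) 0) * g j)"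
      by (rule homogeneous_combination[OF homogeneous_G[OF f] _ v]) (simp add: deg_g)
    then show ?thesis by (rule exI[of _ "\<lambda>j. coef (v $ j) 0"])
  qed
  define c where "c f = (SOME c. f = (\<Sum>j<n. const (c j) * g j))" for f
  have c: "f = (\<Sum>j<n. const (c f j) * g j)" if "f \<in> G" for f
    unfolding c_def by (rule someI_ex[OF c_ex[OF that]])
  have cb: "(\<Sum>j<n. c f' j * b j f) = (if f = f' then 1 else 0)" if f: "f \<in> G" "f' \<in> G" for f f'
  proof -
    \<comment> \<open>Substituting one expansion into the other gives a scalar relation on
      \<open>G\<close> with coefficients \<open>a\<close>, which vanish by independence.\<close>
    define a where "a f = (\<Sum>j<n. c f' j * b j f) - (if f = f' then 1 else 0)" for f
    have "f' = (\<Sum>j<n. const (c f' j) * (\<Sum>f\<in>G. const (b j f) * f))"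
      by (rule trans[OF c[OF f(2)]]) (intro sum.cong arg_cong2[where f = times] refl b, simp)
    also have "\<dots> = (\<Sum>f\<in>G. const (\<Sum>j<n. c f' j * b j f) * f)"
      unfolding sum_distrib_left const_sum sum_distrib_right
      by (subst sum.swap) (simp add: mult_single mult.assoc[symmetric])
    finally have 1: "(\<Sum>f\<in>G. const (\<Sum>j<n. c f' j * b j f) * f) = f'" ..
    have 2: "(\<Sum>f\<in>G. const (if f = f' then 1 else 0) * f) = f'"
    proof -
      have "(\<Sum>f\<in>G. const (if f = f' then 1 else 0) * f) = (\<Sum>f\<in>G. if f = f' then f else 0)"
        by (rule sum.cong) auto
      then show ?thesis using f(2) finite_G by simp
    qed
    have "(\<Sum>f\<in>G. const (a f) * f) = 0"
      unfolding a_def single_diff left_diff_distrib sum_subtractf 1 2 by simp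
    then have "a f = 0" using independent[OF _ f(1)] by blast
    then show ?thesis by (simp add: a_def)
  qed
  have col: "(\<Sum>j<n. s j i * g j) = 0" if i: "i < N" for i
  proof -
    have "M (Suc 0) *\<^sub>v unit_vec N i \<in> mat_image (M (Suc 0))"
      unfolding mat_image_def using M1 by auto
    moreover have "M (Suc 0) *\<^sub>v unit_vec N i = col (M (Suc 0)) i"
      using M1 i by (intro eq_vecI) auto
    ultimately have "col (M (Suc 0)) i \<in> mat_kernel (M 0)" using exact by simp
    then have "(M 0 *\<^sub>v col (M (Suc 0)) i) $ 0 = 0"
      using mat_kernelD(2)[OF M0] by simp
    moreover have "col (M (Suc 0)) i \<in> carrier_vec n" using M1 by auto
    ultimately show ?thesis using M0_mult M1 i by (auto simp: s_def)
  qed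
  have kernel: "\<exists>v. \<forall>j<n. k j = (\<Sum>i<N. v i * s j i)" if "(\<Sum>j<n. k j * g j) = 0" for k
  proof -
    have "vec n k \<in> mat_kernel (M 0)"
    proof (rule mat_kernelI[OF M0])
      show "M 0 *\<^sub>v vec n k = 0\<^sub>v 1"
        using M0 M0_mult[of "vec n k"] that by (intro eq_vecI) auto
    qed simp
    then obtain v where v: "v \<in> carrier_vec N" "vec n k = M (Suc 0) *\<^sub>v v"
      unfolding exact mat_image_def using M1 by auto
    have "vec n k $ j = (\<Sum>i<N. v $ i * s j i)" if "j < n" for j
      unfolding v(2) s_def by (rule mult_mat_vec_index[OF M1 v(1) that])
    then have "k j = (\<Sum>i<N. v $ i * s j i)" if "j < n" for j
      using that by simp
    then show ?thesis by blast
  qed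
  \<comment> \<open>Column \<open>i\<close> of \<open>M (Suc 0)\<close> transported to
    \<open>G\<close> along \<open>b\<close>; its entries have degree 3 - 2 = 1.\<close>
  define l where "l i f = (\<Sum>j<n. const (b j f) * s j i)" for i f
  have syz: "(\<Sum>f\<in>G. l i f * f) = 0" if i: "i < N" for i
  proof -
    have "(\<Sum>f\<in>G. l i f * f) = (\<Sum>j<n. s j i * (\<Sum>f\<in>G. const (b j f) * f))"
      unfolding l_def sum_distrib_left sum_distrib_right
      by (subst sum.swap) (simp add: ac_simps)
    also have "\<dots> = (\<Sum>j<n. s j i * g j)"
      by (intro sum.cong arg_cong2[where f = times] refl b[symmetric]) simp
    finally show ?thesis using col[OF i] by simp
  qed
  have deg_l: "mdeg k = 1" if k: "i < N" "k \<in> supp (l i f)" for i f k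
  proof -
    obtain j where "j < n" "k \<in> supp (const (b j f) * s j i)"
      using k(2) keys_sum[of "\<lambda>j. const (b j f) * s j i" "{..<n}"] unfolding l_def by auto
    then show ?thesis using deg_s[OF _ k(1)] keys_const_mult by blast
  qed
  have "\<exists>i<N. \<exists>f\<in>G. l i f \<noteq> 0"
  proof (rule ccontr)
    assume "\<not> ?thesis"
    then have l_zero: "l i f = 0" if "i < N" "f \<in> G" for i f using that by blast
    \<comment> \<open>By exactness every syzygy of the \<open>g j\<close> is a combination of
      columns, so its transport to \<open>G\<close> is a combination of the vanishing
      \<open>l i\<close>.\<close>
    have pairing_zero: "(\<Sum>j<n. const (b j f) * k j) = 0"
      if f: "f \<in> G" and k: "(\<Sum>j<n. k j * g j) = 0" for f k
    proof -
      obtain v where v: "\<And>j. j < n \<Longrightarrow> k j = (\<Sum>i<N. v i * s j i)" using kernel[OF k] by blast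
      have "(\<Sum>j<n. const (b j f) * k j) = (\<Sum>j<n. \<Sum>i<N. v i * (const (b j f) * s j i))"
        by (rule sum.cong) (simp_all add: v sum_distrib_left ac_simps)
      also have "\<dots> = (\<Sum>i<N. v i * l i f)"
        unfolding l_def sum_distrib_left by (rule sum.swap)
      finally show ?thesis using l_zero f by simp
    qed
    obtain f1 f2 where f: "f1 \<in> G" "f2 \<in> G" "f1 \<noteq> f2"
      using card_G by (auto simp: card_3_iff)
    \<comment> \<open>The Koszul relation of \<open>f1\<close> and \<open>f2\<close>, rewritten in
      the \<open>g j\<close>. Transporting it back, the coordinate at \<open>f1\<close> is
      \<open>f2 * 1 - f1 * 0\<close>.\<close>
    define k where "k j = f2 * const (c f1 j) - f1 * const (c f2 j)" for j
    have "(\<Sum>j<n. k j * g j) =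
        f2 * (\<Sum>j<n. const (c f1 j) * g j) - f1 * (\<Sum>j<n. const (c f2 j) * g j)"
      unfolding k_def by (simp add: left_diff_distrib sum_subtractf sum_distrib_left mult.assoc)
    also have "\<dots> = f2 * f1 - f1 * f2" by (simp only: c[OF f(1), symmetric] c[OF f(2), symmetric])
    finally have "(\<Sum>j<n. k j * g j) = 0" by (simp add: mult.commute)
    then have "0 = (\<Sum>j<n. const (b j f1) * k j)" using pairing_zero[OF f(1)] by simp
    also have "\<dots> = f2 * const (\<Sum>j<n. c f1 j * b j f1) - f1 * const (\<Sum>j<n. c f2 j * b j f1)"
      unfolding k_def const_sum sum_distrib_left right_diff_distrib sum_subtractf
      by (simp add: mult_single[of 0 _ 0, simplified, symmetric] ac_simps)
    also have "\<dots> = f2" using cb f by simp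
    finally have "f2 = 0" ..
    then show False
      using generator_notin[OF f(2)] ideal_class_ringD(1)[OF ideal_ideal_gen[of "G - {f2}"]] by simp
  qed
  then obtain i f where "i < N" "f \<in> G" "l i f \<noteq> 0" by blast
  then show ?thesis using syz[of i] deg_l[of i] by blast
qed


section \<open>Minors of a matrix with two rows and three columns\<close>

lemma det_two_by_two:
  assumes "B \<in> carrier_mat 2 2"
  shows "det B = B $$ (0, 0) * B $$ (1, 1) - B $$ (0, 1) * B $$ (1, 0)"
proof -
  have D: "mat_delete B 0 0 \<in> carrier_mat 1 1" "mat_delete B 1 0 \<in> carrier_mat 1 1"
    using assms by (auto simp: mat_delete_def)
  have "det B = (\<Sum>i<2. B $$ (i, 0) * cofactor B i 0)"
    by (rule laplace_expansion_column[OF assms]) simp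
  also have "\<dots> = B $$ (0, 0) * cofactor B 0 0 + B $$ (1, 0) * cofactor B 1 0"
    by (simp add: numeral_2_eq_2)
  also have "\<dots> = B $$ (0, 0) * B $$ (1, 1) - B $$ (1, 0) * B $$ (0, 1)"
    using D assms by (simp add: cofactor_def det_single mat_delete_def)
  finally show ?thesis by (simp add: mult.commute)
qed

lemma pick_pair:
  assumes "a < b"
  shows "pick {a, b} 0 = a" "pick {a, b} 1 = b"
proof -
  show *: "pick {a, b} 0 = a" using assms by (auto intro!: Least_equality)
  have "pick {a, b} (Suc 0) = (LEAST i. i \<in> {a, b} \<and> i > a)" using * by simp
  also have "\<dots> = b" using assms by (intro Least_equality) auto
  finally show "pick {a, b} 1 = b" by simp
qed

lemma det_submatrix_pair:
  assumes "a < b" "b < dim_row A" "i < j" "j < dim_col A"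
  shows "det (submatrix A {a, b} {i, j}) = A $$ (a, i) * A $$ (b, j) - A $$ (a, j) * A $$ (b, i)"
proof -
  have "{k. k < dim_row A \<and> k \<in> {a, b}} = {a, b}" "{k. k < dim_col A \<and> k \<in> {i, j}} = {i, j}"
    using assms by auto
  then have card: "card {k. k < dim_row A \<and> k \<in> {a, b}} = 2" "card {k. k < dim_col A \<and> k \<in> {i, j}} = 2"
    using assms(1,3) by simp_all
  have "submatrix A {a, b} {i, j} \<in> carrier_mat 2 2"
    by (intro carrier_matI) (simp_all only: dim_submatrix card)
  note det = det_two_by_two[OF this]
  have entry: "submatrix A {a, b} {i, j} $$ (k, m) = A $$ (pick {a, b} k, pick {i, j} m)"
    if "k < 2" "m < 2" for k m
    by (rule submatrix_index) (simp_all only: card that)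
  have lt: "(0::nat) < 2" "(1::nat) < 2" by simp_all
  show ?thesis
    unfolding det entry[OF lt(1) lt(1)] entry[OF lt(1) lt(2)] entry[OF lt(2) lt(1)]
      entry[OF lt(2) lt(2)] pick_pair[OF assms(1)] pick_pair[OF assms(3)] ..
qed

text \<open>Both rows must be chosen, so the minors correspond to the three pairs of
  columns.\<close>

lemma minors_2_by_3:
  assumes A: "A \<in> carrier_mat 2 3"
  shows "minors 2 A = {A $$ (0, 0) * A $$ (1, 1) - A $$ (0, 1) * A $$ (1, 0),
    A $$ (0, 0) * A $$ (1, 2) - A $$ (0, 2) * A $$ (1, 0),
    A $$ (0, 1) * A $$ (1, 2) - A $$ (0, 2) * A $$ (1, 1)}"
proof -
  have R: "R \<subseteq> {..<2} \<and> card R = 2 \<longleftrightarrow> R = {0, 1}" for R :: "nat set"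
  proof
    assume *: "R \<subseteq> {..<2} \<and> card R = 2"
    then have "R = {..<2}" by (intro card_subset_eq) auto
    then show "R = {0, 1}" by auto
  qed auto
  have C: "C \<subseteq> {..<3} \<and> card C = 2 \<longleftrightarrow> C = {0, 1} \<or> C = {0, 2} \<or> C = {1, 2}" for C :: "nat set"
  proof
    assume *: "C \<subseteq> {..<3} \<and> card C = 2"
    then obtain a b where "C = {a, b}" "a \<noteq> b" by (auto simp: card_2_iff)
    moreover from this * have "a \<in> {0, 1, 2}" "b \<in> {0, 1, 2}" by auto
    ultimately show "C = {0, 1} \<or> C = {0, 2} \<or> C = {1, 2}" by auto
  qed auto
  have "minors 2 A = {det (submatrix A R C) | R C.
      (R \<subseteq> {..<2} \<and> card R = 2) \<and> (C \<subseteq> {..<3} \<and> card C = 2)}"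
    unfolding minors_def using A by auto
  also have "\<dots> = {det (submatrix A {0, 1} {0, 1}), det (submatrix A {0, 1} {0, 2}),
      det (submatrix A {0, 1} {1, 2})}"
    unfolding R C by blast
  finally show ?thesis using A by (simp add: det_submatrix_pair)
qed


theorem theorem1p2:
  fixes I :: "('x::finite, 'k::field) mpoly set"
  assumes binomials:
      "\<exists>G. card G = 3 \<and> (\<forall>f\<in>G. quadratic_binomial f) \<and> minimal_generating_set G I"
    and prime: "primeideal I class_ring"
    and linear: "has_linear_resolution 2 I"
  shows "(\<exists>A :: ('x, 'k) mpoly mat. elements_mat A \<subseteq> range Var \<and> I = ideal_gen (minors 2 A)) \<and>
    ((\<exists>G. card G = 3 \<and> (\<forall>f\<in>G. squarefree_quadratic_binomial f) \<and> minimal_generating_set G I) \<longrightarrow>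
     (\<exists>x1 x2 x3 y1 y2 y3 :: 'x. distinct [x1, x2, x3, y1, y2, y3] \<and>
        I = ideal_gen {Var x1 * Var y2 - Var x2 * Var y1,
                       Var x1 * Var y3 - Var x3 * Var y1,
                       Var x2 * Var y3 - Var x3 * Var y2}))"
proof -
  \<comment> \<open>Stated for arbitrary \<open>G\<close> and \<open>e\<close>, since the squarefree
    generators in the second claim may form a different set from those in the first.\<close>
  have main: "\<exists>x1 x2 x3 y1 y2 y3 :: 'x.
      ((\<forall>f\<in>G. \<forall>b. squarefree_monomial (e f b)) \<longrightarrow> distinct [x1, x2, x3, y1, y2, y3]) \<and>
      I = ideal_gen {Var x1 * Var y2 - Var x2 * Var y1,
        Var x1 * Var y3 - Var x3 * Var y1, Var x2 * Var y3 - Var x3 * Var y2}"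
    if "card G = 3" "minimal_generating_set G I" and e: "\<forall>f\<in>G. e f True \<noteq> e f False \<and>
      (\<forall>b. mdeg (e f b) = 2) \<and> f = mmonom (e f True) - mmonom (e f False)"
    for G :: "('x, 'k) mpoly set" and e
  proof -
    interpret binomial_prime I G e
      using that prime by (intro binomial_prime.intro) blast+
    obtain l f0 where l: "(\<Sum>f\<in>G. l f * f) = 0" "\<forall>f\<in>G. \<forall>k\<in>supp (l f). mdeg k = 1"
      "f0 \<in> G" "l f0 \<noteq> 0"
      using linear_syzygy[OF linear] by blast
    have "\<exists>x f b y g c z h d. triangle x f b y g c z h d"
      by (rule triangle_of_linear_syzygy[of l f0]) (use l in blast)+
    then obtain x f b y g c z h d where T: "triangle x f b y g c z h d" by blast
    obtain p q r where pqr: "e f b = mvar z + mvar p" "e f (\<not> b) = mvar y + mvar q"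
      "e g c = mvar x + mvar q" "e g (\<not> c) = mvar z + mvar r"
      "e h d = mvar y + mvar r" "e h (\<not> d) = mvar x + mvar p"
      by (rule triangle_variables[OF T])
    show ?thesis
      using ideal_of_triangle[OF T pqr] triangle_variables_distinct[OF T pqr] by blast
  qed
  show ?thesis
  proof (intro conjI impI)
    obtain G where G: "card G = 3" "minimal_generating_set G I" "\<forall>f\<in>G. quadratic_binomial f"
      using binomials by blast
    have "\<forall>f\<in>G. \<exists>u. u True \<noteq> u False \<and> (\<forall>b. mdeg (u b) = 2) \<and>
      f = mmonom (u True) - mmonom (u False)"
    proof
      fix f assume "f \<in> G"
      then obtain u v where uv: "u \<noteq> v" "mdeg u = 2" "mdeg v = 2" "f = mmonom u - mmonom v"
        using G(3) unfolding quadratic_binomial_def by blast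
      show "\<exists>u. u True \<noteq> u False \<and> (\<forall>b. mdeg (u b) = 2) \<and>
          f = mmonom (u True) - mmonom (u False)"
        by (rule exI[of _ "\<lambda>b. if b then u else v"]) (simp add: uv(1-3), rule uv(4))
    qed
    from bchoice[OF this] obtain e where "\<forall>f\<in>G. e f True \<noteq> e f False \<and>
      (\<forall>b. mdeg (e f b) = 2) \<and> f = mmonom (e f True) - mmonom (e f False)"
      by blast
    from main[OF G(1,2) this] obtain x1 x2 x3 y1 y2 y3 :: 'x where
      I: "I = ideal_gen {Var x1 * Var y2 - Var x2 * Var y1,
        Var x1 * Var y3 - Var x3 * Var y1, Var x2 * Var y3 - Var x3 * Var y2}" by blast
    define A :: "('x, 'k) mpoly mat" where
      "A = mat 2 3 (\<lambda>(i, j). Var ([[x1, x2, x3], [y1, y2, y3]] ! i ! j))"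
    have "elements_mat A \<subseteq> range Var" unfolding A_def by auto
    moreover have "minors 2 A = {Var x1 * Var y2 - Var x2 * Var y1,
        Var x1 * Var y3 - Var x3 * Var y1, Var x2 * Var y3 - Var x3 * Var y2}"
      using minors_2_by_3[of A] by (simp add: A_def)
    ultimately show "\<exists>A :: ('x, 'k) mpoly mat. elements_mat A \<subseteq> range Var \<and> I = ideal_gen (minors 2 A)"
      unfolding I by (intro exI[of _ A] conjI) simp_all
  next
    assume "\<exists>G. card G = 3 \<and> (\<forall>f\<in>G. squarefree_quadratic_binomial f) \<and> minimal_generating_set G I"
    then obtain G where G: "card G = 3" "minimal_generating_set G I"
      "\<forall>f\<in>G. squarefree_quadratic_binomial f" by blast
    \<comment> \<open>Squarefreeness is part of the choice, so that the same \<open>e\<close> both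
      encodes the generators and has squarefree values.\<close>
    have "\<forall>f\<in>G. \<exists>u. (u True \<noteq> u False \<and> (\<forall>b. mdeg (u b) = 2) \<and>
      f = mmonom (u True) - mmonom (u False)) \<and> (\<forall>b. squarefree_monomial (u b))"
    proof
      fix f assume "f \<in> G"
      then obtain u v where uv: "u \<noteq> v" "mdeg u = 2" "mdeg v = 2" "f = mmonom u - mmonom v"
        "squarefree_monomial u" "squarefree_monomial v"
        using G(3) unfolding squarefree_quadratic_binomial_def by blast
      show "\<exists>u. (u True \<noteq> u False \<and> (\<forall>b. mdeg (u b) = 2) \<and>
          f = mmonom (u True) - mmonom (u False)) \<and> (\<forall>b. squarefree_monomial (u b))"
        by (rule exI[of _ "\<lambda>b. if b then u else v"]) (simp add: uv(1-3,5,6), rule uv(4))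
    qed
    from bchoice[OF this] obtain e where e: "\<forall>f\<in>G. e f True \<noteq> e f False \<and>
      (\<forall>b. mdeg (e f b) = 2) \<and> f = mmonom (e f True) - mmonom (e f False)"
      and sqf: "\<forall>f\<in>G. \<forall>b. squarefree_monomial (e f b)"
      by blast
    from main[OF G(1,2) e] sqf show "\<exists>x1 x2 x3 y1 y2 y3 :: 'x. distinct [x1, x2, x3, y1, y2, y3] \<and>
        I = ideal_gen {Var x1 * Var y2 - Var x2 * Var y1,
                       Var x1 * Var y3 - Var x3 * Var y1,
                       Var x2 * Var y3 - Var x3 * Var y2}" by blast
  qed
qed

end
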